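(* Let $(\mathbb X,d,\mu)$ be a compact length metric measure space ($\mu$ a Borel probability measure). Then there exist finite graphs $G_n$, equipped with a distance $d_n$ and a probability measure $\mu_n$, such that $(G_n,d_n,\mu_n)\to(\mathbb X,d,\mu)$ in the measured Gromov–Hausdorff topology. In particular, for every integer $k\ge1$ and real $p\ge1$: for every $\varepsilon>0$, if $n$ is large enough, any set of $k$-barycenters $S_n\in\mathcal S_{\mathcal X_n}(k)$ of $\mathcal X_n=(G_n,d_n,\mu_n)$ is $\varepsilon$-close, in the Hausdorff distance of $(\mathbb X,d)$, to some set $S\in\mathcal S_{\mathcal X}(k)$ of $k$-barycenters of $\mathcal X=(\mathbb X,d,\mu)$, where $S_n$ is identified with its image $h_n(S_n)\subset\mathbb X$ under the $\varepsilon_n$-isometries $h_n\colon G_n\to\mathbb X$ realizing the convergence.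
   Context: A length space is a metric space in which the distance between two points is the infimum of the lengths of curves joining them. A finite graph $G_n$ is regarded as the finite metric space of its vertices, each edge having a positive length, with $d_n$ the induced shortest-path distance, and $\mu_n$ is a probability measure on the vertices. A map $h\colon(\mathbb X,d_{\mathbb X})\to(\mathbb Y,d_{\mathbb Y})$ is an $\varepsilon$-isometry if $|d_{\mathbb X}(x,x')-d_{\mathbb Y}(h(x),h(x'))|<\varepsilon$ for all $x,x'$, and $d_{\mathbb Y}(y,h(\mathbb X))<\varepsilon$ for all $y\in\mathbb Y$. Measured Gromov–Hausdorff convergence $(\mathbb X_n,d_n,\mu_n)\to(\mathbb X,d,\mu)$ means that there are $\varepsilon_n\to0$ and $\varepsilon_n$-isometries $h_n\colon\mathbb X_n\to\mathbb X$ with $(h_n)_{\#}\mu_n\to\mu$ weakly. For a compact metric space with probability measure $\mathcal Y=(\mathbb Y,\rho,\nu)$, $\mathcal S_{\mathcal Y}(k)$ (sets of $k$-means, or $k$-barycenters) is the set of minimizers of $\int_{\mathbb Y}\min_{x\in S}\rho(y,x)^p\,\nu(dy)$ over nonempty subsets $S\subset\mathbb Y$ with at most $k$ elements. *)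

theory Defs
  imports
    "HOL-Probability.Probability"
    "Graph_Theory.Graph_Theory"
begin

definition curve_length :: "(real \<Rightarrow> 'a::metric_space) \<Rightarrow> ennreal" where
  "curve_length g =
     (SUP ts \<in> {ts. sorted ts \<and> set ts \<subseteq> {0..1}}.
        ennreal (\<Sum>i<length ts - 1. dist (g (ts ! i)) (g (ts ! Suc i))))"

(* The curves run inside X. Over an empty set of curves the infimum is infinite, so any two
   points of a length space are joined by curves of finite length. *)
definition length_space :: "'a::metric_space set \<Rightarrow> bool" where
  "length_space X \<longleftrightarrow>
     (\<forall>x\<in>X. \<forall>y\<in>X. ennreal (dist x y) =
        (INF g \<in> {g. path g \<and> path_image g \<subseteq> X \<and> pathstart g = x \<and> pathfinish g = y}.
           curve_length g))"

(* Finite simple connected undirected graphs: as usual in Graph_Theory, an undirected edge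
   is a pair of opposite arcs, hence the symmetry condition on the edge lengths w. *)
definition metric_graph :: "'v pair_pre_digraph \<Rightarrow> ('v \<times> 'v \<Rightarrow> real) \<Rightarrow> bool" where
  "metric_graph G w \<longleftrightarrow>
     pair_graph G \<and> Digraph_Component.connected (with_proj G) \<and>
     (\<forall>e\<in>parcs G. 0 < w e) \<and>
     (\<forall>u v. (u, v) \<in> parcs G \<longrightarrow> w (u, v) = w (v, u))"

(* wf_digraph.\<mu> is the infimum of the lengths of the walks between two vertices; it is
   finite on the vertices of a metric graph. *)
definition graph_dist :: "'v pair_pre_digraph \<Rightarrow> ('v \<times> 'v \<Rightarrow> real) \<Rightarrow> 'v \<Rightarrow> 'v \<Rightarrow> real" where
  "graph_dist G w u v = real_of_ereal (wf_digraph.\<mu> (with_proj G) w u v)"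

(* infdist is 0 for the empty set; below, the source A always carries a probability measure
   and hence is nonempty. *)
definition eps_isometry ::
    "real \<Rightarrow> 'b set \<Rightarrow> ('b \<Rightarrow> 'b \<Rightarrow> real) \<Rightarrow> 'a::metric_space set \<Rightarrow> ('b \<Rightarrow> 'a) \<Rightarrow> bool" where
  "eps_isometry e A d X h \<longleftrightarrow>
     h \<in> A \<rightarrow> X \<and>
     (\<forall>x\<in>A. \<forall>x'\<in>A. \<bar>d x x' - dist (h x) (h x')\<bar> < e) \<and>
     (\<forall>y\<in>X. infdist y (h ` A) < e)"

definition converges_weakly ::
    "'a::metric_space set \<Rightarrow> (nat \<Rightarrow> 'a measure) \<Rightarrow> 'a measure \<Rightarrow> bool" where
  "converges_weakly X N M \<longleftrightarrow>
     (\<forall>f :: 'a \<Rightarrow> real. continuous_on X f \<and> bounded (f ` X) \<longrightarrow>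
        (\<lambda>n. integral\<^sup>L (N n) f) \<longlonglongrightarrow> integral\<^sup>L M f)"

(* The numbers e n and the maps h n realize the convergence of (A n, d n, m n) to (X, dist, M). *)
definition realizes_mGH ::
    "(nat \<Rightarrow> 'b set) \<Rightarrow> (nat \<Rightarrow> 'b \<Rightarrow> 'b \<Rightarrow> real) \<Rightarrow> (nat \<Rightarrow> 'b measure) \<Rightarrow>
     'a::metric_space set \<Rightarrow> 'a measure \<Rightarrow> (nat \<Rightarrow> real) \<Rightarrow> (nat \<Rightarrow> 'b \<Rightarrow> 'a) \<Rightarrow> bool" where
  "realizes_mGH A d m X M e h \<longleftrightarrow>
     e \<longlonglongrightarrow> 0 \<and>
     (\<forall>n. eps_isometry (e n) (A n) (d n) X (h n) \<and> h n \<in> measurable (m n) M) \<and>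
     converges_weakly X (\<lambda>n. distr (m n) M (h n)) M"

definition mGH_converges ::
    "(nat \<Rightarrow> 'b set) \<Rightarrow> (nat \<Rightarrow> 'b \<Rightarrow> 'b \<Rightarrow> real) \<Rightarrow> (nat \<Rightarrow> 'b measure) \<Rightarrow>
     'a::metric_space set \<Rightarrow> 'a measure \<Rightarrow> bool" where
  "mGH_converges A d m X M \<longleftrightarrow> (\<exists>e h. realizes_mGH A d m X M e h)"

definition barycenter_cost ::
    "('b \<Rightarrow> 'b \<Rightarrow> real) \<Rightarrow> 'b measure \<Rightarrow> real \<Rightarrow> 'b set \<Rightarrow> ennreal" where
  "barycenter_cost rho N p S = (\<integral>\<^sup>+ y. ennreal (Min ((\<lambda>x. rho y x powr p) ` S)) \<partial>N)"

definition admissible_sets :: "'b set \<Rightarrow> nat \<Rightarrow> 'b set set" where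
  "admissible_sets Y k = {S. S \<subseteq> Y \<and> S \<noteq> {} \<and> finite S \<and> card S \<le> k}"

definition k_barycenters ::
    "'b set \<Rightarrow> ('b \<Rightarrow> 'b \<Rightarrow> real) \<Rightarrow> 'b measure \<Rightarrow> real \<Rightarrow> nat \<Rightarrow> 'b set set" where
  "k_barycenters Y rho N p k =
     {S \<in> admissible_sets Y k.
        \<forall>T \<in> admissible_sets Y k. barycenter_cost rho N p S \<le> barycenter_cost rho N p T}"

(* Only meaningful for nonempty bounded sets. *)
definition hausdorff_distance :: "'a::metric_space set \<Rightarrow> 'a set \<Rightarrow> real" where
  "hausdorff_distance A B = max (SUP a\<in>A. infdist a B) (SUP b\<in>B. infdist b A)"

end

theory Submission
  imports Defs
begin

text \<open>
  The approximating graph is the complete graph on a finite net of mesh \<open>1 / (n + 1)\<close>, each edge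
  having as length the distance of its endpoints: by the triangle inequality no walk is shorter than
  the edge joining its ends, so the graph distance is the restriction of the ambient one. The measure
  is the image of \<open>M\<close> under the map sending a point to the first net point near it, and
  weak convergence is dominated convergence.

  For the barycenters, uniform continuity of \<open>u powr p\<close> on bounded sets and weak convergence against
  the continuous function \<open>y \<mapsto> Min {dist y t powr p | t \<in> T}\<close> show that the cost of
  \<open>S \<subseteq> A n\<close> is close to the cost of \<open>T \<subseteq> X\<close> as soon as
  \<open>h n ` S\<close> is close to \<open>T\<close>. Every \<open>T\<close> is approximated by sets
  \<open>h n ` S\<close> of no larger cardinality, so a limit of barycenters is a barycenter, and the
  claim follows by extracting a convergent subsequence.
\<close>

section \<open>Complete graphs carrying a given metric\<close>

text \<open>Loops are left out because a \<open>pair_graph\<close> has none. The arc set is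
  symmetric, as an undirected graph requires.\<close>

definition complete_pair_graph :: "'v set \<Rightarrow> 'v pair_pre_digraph" where
  "complete_pair_graph V = \<lparr> pverts = V, parcs = {(u, v). u \<in> V \<and> v \<in> V \<and> u \<noteq> v} \<rparr>"

lemma complete_pair_graph_simps [simp]:
  "pverts (complete_pair_graph V) = V"
  "parcs (complete_pair_graph V) = {(u, v). u \<in> V \<and> v \<in> V \<and> u \<noteq> v}"
  by (simp_all add: complete_pair_graph_def)

lemma pair_graph_complete_pair_graph:
  assumes "finite V"
  shows "pair_graph (complete_pair_graph V)"
proof -
  have "finite {(u, v). u \<in> V \<and> v \<in> V \<and> u \<noteq> v}"
    by (rule finite_subset[of _ "V \<times> V"]) (use assms in auto)
  then show ?thesis
    using assms by unfold_locales (auto simp: symmetric_def intro: symI)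
qed

text \<open>Injectivity of \<open>x\<close> is what makes the edge lengths positive. Distinct
  vertices are adjacent, so reachability needs at most one arc.\<close>

lemma metric_graph_complete_pair_graph:
  fixes x :: "'v \<Rightarrow> 'a::metric_space"
  assumes "finite V" "V \<noteq> {}" "inj_on x V"
  shows "metric_graph (complete_pair_graph V) (\<lambda>(u, v). dist (x u) (x v))"
proof -
  interpret pair_graph "complete_pair_graph V"
    by (rule pair_graph_complete_pair_graph) fact
  have "Digraph_Component.connected (with_proj (complete_pair_graph V))"
  proof (rule connectedI)
    fix u v
    assume uv: "u \<in> pverts (complete_pair_graph V)" "v \<in> pverts (complete_pair_graph V)"
    have "u \<rightarrow>\<^sup>*\<^bsub>with_proj (complete_pair_graph V)\<^esub> v"
    proof (cases "u = v")
      case True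
      with uv show ?thesis by (simp add: reachable_refl)
    next
      case False
      with uv show ?thesis by (intro reachable_adjI) simp
    qed
    then show "u \<rightarrow>\<^sup>*\<^bsub>mk_symmetric (with_proj (complete_pair_graph V))\<^esub> v"
      by (rule reachable_mk_symmetricI)
  qed (use assms in simp)
  then show ?thesis
    using assms pair_graph_axioms
    by (auto simp: metric_graph_def dist_commute inj_on_def)
qed

lemma graph_dist_complete_pair_graph:
  fixes x :: "'v \<Rightarrow> 'a::metric_space"
  assumes "finite V" "u \<in> V" "v \<in> V"
  shows "graph_dist (complete_pair_graph V) (\<lambda>(u, v). dist (x u) (x v)) u v = dist (x u) (x v)"
proof -
  let ?w = "\<lambda>(u, v). dist (x u) (x v)"
  interpret pair_graph "complete_pair_graph V"
    by (rule pair_graph_complete_pair_graph) fact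
  \<comment> \<open>The start vertex varies because the induction strips the first arc off the walk,
    while the end \<open>v\<close> stays fixed.\<close>
  have lower: "dist (x u) (x v) \<le> awalk_cost ?w p" if "awalk u p v" for p u
    using that
  proof (induction p arbitrary: u)
    case Nil
    then show ?case by (simp add: awalk_def)
  next
    case (Cons e p)
    then have "fst e = u" "awalk (snd e) p v"
      by (auto simp: awalk_Cons_iff)
    with Cons.IH[of "snd e"] show ?case
      using dist_triangle[of "x u" "x v" "x (snd e)"]
      by (auto simp: case_prod_beta)
  qed
  \<comment> \<open>The lower bound is attained by a single arc or, on the diagonal, where there is
    no arc, by the empty walk of cost 0.\<close>
  obtain p where p: "awalk u p v" "awalk_cost ?w p = dist (x u) (x v)"
  proof (cases "u = v")
    case True
    with assms show ?thesis by (intro that[of "[]"]) (auto simp: awalk_def)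
  next
    case False
    with assms show ?thesis by (intro that[of "[(u, v)]"]) (auto simp: awalk_def)
  qed
  have "\<mu> ?w u v = ereal (dist (x u) (x v))"
  proof (rule antisym)
    show "\<mu> ?w u v \<le> ereal (dist (x u) (x v))"
      using min_cost_le_walk_cost[OF p(1), of ?w] p(2) by simp
    show "ereal (dist (x u) (x v)) \<le> \<mu> ?w u v"
      unfolding \<mu>_def by (rule INF_greatest) (use lower in auto)
  qed
  then show ?thesis
    by (simp add: graph_dist_def)
qed

section \<open>Discretization of a compact metric measure space\<close>

text \<open>Total boundedness gives the net. Numbering it without repetition makes the vertices
  natural numbers and lets a first net point near \<open>y\<close> be singled out.\<close>

lemma compact_finite_net_nat:
  fixes X :: "'a::metric_space set"
  assumes "compact X" "0 < e"
  shows "\<exists>(x :: nat \<Rightarrow> 'a) N. inj_on x {..<N} \<and> x ` {..<N} \<subseteq> X \<and>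
    (\<forall>y\<in>X. \<exists>i<N. dist (x i) y < e)"
proof -
  obtain F where F: "finite F" "F \<subseteq> X" "X \<subseteq> (\<Union>x\<in>F. ball x e)"
    using seq_compact_imp_totally_bounded[of X] assms compact_imp_seq_compact by metis
  obtain N :: nat and x where x: "F = x ` {i. i < N}" "inj_on x {i. i < N}"
    using finite_imp_nat_seg_image_inj_on[OF F(1)] by metis
  have "\<exists>i<N. dist (x i) y < e" if "y \<in> X" for y
    using F(3) x(1) that by (fastforce simp: dist_commute)
  moreover have "inj_on x {..<N}" "x ` {..<N} \<subseteq> X"
    using x F(2) by (auto simp: lessThan_def)
  ultimately show ?thesis by blast
qed

text \<open>Taking the least index makes the choice of a net point measurable, since it is decided
  by the countably many measurable conditions \<open>dist (x i) y < e\<close>.\<close>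

lemma measurable_nearby_index:
  fixes X :: "'a::metric_space set" and x :: "nat \<Rightarrow> 'a"
  assumes sets: "sets M = sets (restrict_space borel X)"
    and cover: "\<And>y. y \<in> X \<Longrightarrow> \<exists>i<N. dist (x i) y < e"
  shows "(\<lambda>y. LEAST i. dist (x i) y < e) \<in> measurable M (count_space {..<N})"
proof -
  have space: "space M = X"
    using sets_eq_imp_space_eq[OF sets] by (simp add: space_restrict_space)
  have pred: "Measurable.pred M (\<lambda>y. dist (x i) y < e)" for i
  proof -
    have "(\<lambda>y. dist (x i) y) \<in> borel_measurable (restrict_space borel X)"
      by (intro borel_measurable_continuous_on_restrict continuous_intros)
    then have [measurable]: "(\<lambda>y. dist (x i) y) \<in> borel_measurable M"
      by (simp cong: measurable_cong_sets add: sets)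
    show ?thesis by measurable
  qed
  have meas: "(\<lambda>y. LEAST i. dist (x i) y < e) \<in> measurable M (count_space UNIV)"
    by (rule measurable_Least) (rule pred)
  \<comment> \<open>A covering index bounds the least one, so the values stay inside the vertex
    set.\<close>
  have "(LEAST i. dist (x i) y < e) < N" if "y \<in> X" for y
    using cover[OF that] by (metis Least_le order_le_less_trans)
  then show ?thesis
    using meas by (auto simp: measurable_count_space_eq2 measurable_count_space_eq2_countable space)
qed

text \<open>After a change of variables, \<open>f (g n y)\<close> tends to \<open>f y\<close> by
  continuity, and a bound of \<open>f\<close> on \<open>X\<close> is an integrable majorant because
  \<open>M\<close> has mass one.\<close>

lemma converges_weakly_distr_self:
  fixes X :: "'a::metric_space set"
  assumes "prob_space M" and sets: "sets M = sets (restrict_space borel X)"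
    and g: "\<And>n. g n \<in> measurable M M"
    and lim: "\<And>y. y \<in> X \<Longrightarrow> (\<lambda>n. g n y) \<longlonglongrightarrow> y"
  shows "converges_weakly X (\<lambda>n. distr M M (g n)) M"
  unfolding converges_weakly_def
proof (intro allI impI)
  interpret prob_space M by fact
  have space: "space M = X"
    using sets_eq_imp_space_eq[OF sets] by (simp add: space_restrict_space)
  fix f :: "'a \<Rightarrow> real" assume f: "continuous_on X f \<and> bounded (f ` X)"
  then obtain B where B: "\<And>y. y \<in> X \<Longrightarrow> norm (f y) \<le> B"
    unfolding bounded_iff by auto
  have "f \<in> borel_measurable (restrict_space borel X)"
    using f by (intro borel_measurable_continuous_on_restrict) auto
  then have fm [measurable]: "f \<in> borel_measurable M"
    by (simp cong: measurable_cong_sets add: sets)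
  note g [measurable]
  have gX: "g n y \<in> X" if "y \<in> X" for n y
    using measurable_space[OF g] that space by auto
  have "(\<lambda>n. integral\<^sup>L M (\<lambda>y. f (g n y))) \<longlonglongrightarrow> integral\<^sup>L M f"
  proof (rule integral_dominated_convergence)
    show "integrable M (\<lambda>y. B)" by simp
    show "AE y in M. (\<lambda>n. f (g n y)) \<longlonglongrightarrow> f y"
    proof (rule AE_I2)
      fix y assume "y \<in> space M"
      then show "(\<lambda>n. f (g n y)) \<longlonglongrightarrow> f y"
        using continuous_on_tendsto_compose[OF _ lim, of X f y] f gX space by auto
    qed
    show "AE y in M. norm (f (g n y)) \<le> B" for n
      using B gX space by (auto intro!: AE_I2)
  qed measurable
  then show "(\<lambda>n. integral\<^sup>L (distr M M (g n)) f) \<longlonglongrightarrow> integral\<^sup>L M f"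
    by (simp add: integral_distr[OF g fm])
qed

lemma compact_metric_measure_discretization:
  fixes X :: "'a::metric_space set" and M :: "'a measure"
  assumes "compact X" "prob_space M"
    and sets: "sets M = sets (restrict_space borel X)"
  obtains N :: "nat \<Rightarrow> nat" and x :: "nat \<Rightarrow> nat \<Rightarrow> 'a" and m :: "nat \<Rightarrow> nat measure"
  where "\<forall>n. N n > 0 \<and> inj_on (x n) {..<N n} \<and> prob_space (m n) \<and> sets (m n) = Pow {..<N n}"
    "realizes_mGH (\<lambda>n. {..<N n}) (\<lambda>n i j. dist (x n i) (x n j)) m X M (\<lambda>n. inverse (real (Suc n))) x"
proof -
  interpret prob_space M by fact
  have space: "space M = X"
    using sets_eq_imp_space_eq[OF sets] by (simp add: space_restrict_space)
  let ?e = "\<lambda>n. inverse (real (Suc n))"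
  have "\<forall>n. \<exists>(x :: nat \<Rightarrow> 'a) N. inj_on x {..<N} \<and> x ` {..<N} \<subseteq> X \<and> (\<forall>y\<in>X. \<exists>i<N. dist (x i) y < ?e n)"
    by (intro allI compact_finite_net_nat \<open>compact X\<close>) simp
  then have "\<exists>(x :: nat \<Rightarrow> nat \<Rightarrow> 'a) N. \<forall>n. inj_on (x n) {..<N n} \<and> x n ` {..<N n} \<subseteq> X \<and>
      (\<forall>y\<in>X. \<exists>i<N n. dist (x n i) y < ?e n)"
    unfolding choice_iff .
  then obtain x :: "nat \<Rightarrow> nat \<Rightarrow> 'a" and N :: "nat \<Rightarrow> nat" where
    net: "\<forall>n. inj_on (x n) {..<N n} \<and> x n ` {..<N n} \<subseteq> X \<and>
      (\<forall>y\<in>X. \<exists>i<N n. dist (x n i) y < ?e n)"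
    by (elim exE)
  then have inj: "inj_on (x n) {..<N n}" and xX: "x n ` {..<N n} \<subseteq> X" for n
    by simp_all
  have cover: "\<exists>i<N n. dist (x n i) y < ?e n" if "y \<in> X" for n y
    using net that by (elim allE[of _ n] conjE) (rule bspec)
  \<comment> \<open>The fibres of \<open>q n\<close> cut \<open>X\<close> into pieces, each within
    the mesh of one net point. The measure \<open>m n\<close> gives a vertex the mass of its
    piece.\<close>
  define q where "q n y = (LEAST i. dist (x n i) y < ?e n)" for n y
  define m where "m n = distr M (count_space {..<N n}) (q n)" for n
  have q: "q n \<in> measurable M (count_space {..<N n})" for n
    unfolding q_def using measurable_nearby_index[OF sets cover] by simp
  have q_dist: "dist (x n (q n y)) y < ?e n" if "y \<in> X" for n y
    using cover[OF that, of n] unfolding q_def by (metis LeastI)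
  have sets_m: "sets (m n) = Pow {..<N n}" for n
    by (simp add: m_def)
  have x_meas: "x n \<in> measurable (count_space {..<N n}) M" for n
    using xX space by auto
  \<comment> \<open>A probability space is nonempty, hence so is every net.\<close>
  have N: "N n > 0" for n
  proof -
    obtain y where "y \<in> X" using not_empty space by blast
    from cover[OF this, of n] show ?thesis by (elim exE conjE) simp
  qed
  have e0: "?e \<longlonglongrightarrow> 0"
    by (rule LIMSEQ_inverse_real_of_nat)
  show ?thesis
  proof (rule that[of N x m])
    have "prob_space (m n)" for n
      unfolding m_def by (rule prob_space_distr) (rule q)
    then show "\<forall>n. N n > 0 \<and> inj_on (x n) {..<N n} \<and> prob_space (m n) \<and>
        sets (m n) = Pow {..<N n}"
      using N inj sets_m by simp
    \<comment> \<open>Pushing \<open>m n\<close> forward along \<open>x n\<close> amounts to pushing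
      \<open>M\<close> forward along the composite of \<open>q n\<close> and \<open>x n\<close>,
      which moves each point by less than the mesh.\<close>
    have "converges_weakly X (\<lambda>n. distr M M (\<lambda>y. x n (q n y))) M"
    proof (rule converges_weakly_distr_self[OF \<open>prob_space M\<close> sets])
      show "(\<lambda>y. x n (q n y)) \<in> measurable M M" for n
        using q x_meas by (rule measurable_compose)
      show "(\<lambda>n. x n (q n y)) \<longlonglongrightarrow> y" if "y \<in> X" for y
        by (rule metric_tendsto_imp_tendsto[OF e0])
          (use q_dist[OF that] in \<open>auto intro!: always_eventually less_imp_le\<close>)
    qed
    moreover have "distr (m n) M (x n) = distr M M (\<lambda>y. x n (q n y))" for n
      unfolding m_def by (subst distr_distr[OF x_meas q]) (simp add: comp_def)
    ultimately have "converges_weakly X (\<lambda>n. distr (m n) M (x n)) M"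
      by simp
    moreover have "x n \<in> measurable (m n) M" for n
      using x_meas[of n] by (simp add: m_def)
    \<comment> \<open>The distance on indices is pulled back along \<open>x n\<close>, so there is
      no distortion; only density of the net costs the mesh.\<close>
    moreover have "eps_isometry (?e n) {..<N n} (\<lambda>i j. dist (x n i) (x n j)) X (x n)" for n
    proof -
      have "infdist y (x n ` {..<N n}) < ?e n" if y: "y \<in> X" for y
      proof -
        obtain i where i: "i < N n" "dist (x n i) y < ?e n"
          using cover[OF y] by blast
        then have "infdist y (x n ` {..<N n}) \<le> dist y (x n i)"
          by (intro infdist_le) auto
        with i show ?thesis by (simp add: dist_commute)
      qed
      then show ?thesis
        using xX[of n] by (auto simp: eps_isometry_def)
    qed
    ultimately show "realizes_mGH (\<lambda>n. {..<N n}) (\<lambda>n i j. dist (x n i) (x n j)) m X M ?e x"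
      using e0 by (simp add: realizes_mGH_def)
  qed
qed

section \<open>Stability of barycenters\<close>

text \<open>A minimizer on either side has a partner on the other whose value is within
  \<open>c\<close>, and this value bounds the other minimum from above. No bijection between
  \<open>A\<close> and \<open>B\<close> is involved, so their cardinalities may differ.\<close>

lemma abs_Min_diff_le:
  fixes f :: "'b \<Rightarrow> real" and g :: "'c \<Rightarrow> real"
  assumes "finite A" "A \<noteq> {}" "finite B" "B \<noteq> {}"
    and AB: "\<And>a. a \<in> A \<Longrightarrow> \<exists>b\<in>B. \<bar>f a - g b\<bar> \<le> c"
    and BA: "\<And>b. b \<in> B \<Longrightarrow> \<exists>a\<in>A. \<bar>f a - g b\<bar> \<le> c"
  shows "\<bar>Min (f ` A) - Min (g ` B)\<bar> \<le> c"
proof -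
  obtain a where a: "a \<in> A" "Min (f ` A) = f a"
    using Min_in[of "f ` A"] assms(1,2) by (auto simp del: Min_in)
  obtain b where b: "b \<in> B" "Min (g ` B) = g b"
    using Min_in[of "g ` B"] assms(3,4) by (auto simp del: Min_in)
  obtain b' where b': "b' \<in> B" "\<bar>f a - g b'\<bar> \<le> c" using AB a by blast
  obtain a' where a': "a' \<in> A" "\<bar>f a' - g b\<bar> \<le> c" using BA b by blast
  have "f a \<le> f a'" using a(2) a'(1) assms Min_le[of "f ` A" "f a'"] by auto
  moreover have "g b \<le> g b'" using b(2) b'(1) assms Min_le[of "g ` B" "g b'"] by auto
  ultimately show ?thesis using a(2) b(2) a'(2) b'(2) by linarith
qed

text \<open>A real-valued form of the cost, in which differences can be estimated; it agrees with
  \<open>barycenter_cost\<close> for bounded, nonnegative, measurable integrands.\<close>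

definition mean_cost :: "('b \<Rightarrow> 'b \<Rightarrow> real) \<Rightarrow> 'b measure \<Rightarrow> real \<Rightarrow> 'b set \<Rightarrow> real" where
  "mean_cost rho N p S = integral\<^sup>L N (\<lambda>y. Min ((\<lambda>x. rho y x powr p) ` S))"

lemma Min_powr_bounds:
  fixes rho :: "'b \<Rightarrow> 'b \<Rightarrow> real"
  assumes "finite S" "S \<noteq> {}" "0 \<le> p" "\<And>x. x \<in> S \<Longrightarrow> 0 \<le> rho y x \<and> rho y x \<le> B"
  shows "0 \<le> Min ((\<lambda>x. rho y x powr p) ` S)" "Min ((\<lambda>x. rho y x powr p) ` S) \<le> B powr p"
proof -
  have "Min ((\<lambda>x. rho y x powr p) ` S) \<in> (\<lambda>x. rho y x powr p) ` S"
    using assms by (intro Min_in) auto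
  then obtain x where "x \<in> S" "Min ((\<lambda>x. rho y x powr p) ` S) = rho y x powr p"
    by auto
  then show "0 \<le> Min ((\<lambda>x. rho y x powr p) ` S)" "Min ((\<lambda>x. rho y x powr p) ` S) \<le> B powr p"
    using assms(3) assms(4)[of x] by (auto intro: powr_mono2)
qed

lemma
  assumes "prob_space N" "finite S" "S \<noteq> {}" "0 \<le> p"
    and bounds: "\<And>x y. x \<in> S \<Longrightarrow> y \<in> space N \<Longrightarrow> 0 \<le> rho y x \<and> rho y x \<le> B"
    and meas: "(\<lambda>y. Min ((\<lambda>x. rho y x powr p) ` S)) \<in> borel_measurable N"
  shows integrable_Min_powr: "integrable N (\<lambda>y. Min ((\<lambda>x. rho y x powr p) ` S))"
    and barycenter_cost_eq_mean_cost: "barycenter_cost rho N p S = ennreal (mean_cost rho N p S)"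
    and mean_cost_nonneg: "0 \<le> mean_cost rho N p S"
proof -
  interpret prob_space N by fact
  have Min_bounds: "0 \<le> Min ((\<lambda>x. rho y x powr p) ` S)"
    "Min ((\<lambda>x. rho y x powr p) ` S) \<le> B powr p" if "y \<in> space N" for y
    using Min_powr_bounds[of S p rho y B] assms(2-4) bounds that by blast+
  show int: "integrable N (\<lambda>y. Min ((\<lambda>x. rho y x powr p) ` S))"
    by (rule integrable_const_bound[of _ "B powr p", OF AE_I2 meas]) (use Min_bounds in simp)
  show "barycenter_cost rho N p S = ennreal (mean_cost rho N p S)"
    unfolding barycenter_cost_def mean_cost_def
    by (rule nn_integral_eq_integral[OF int AE_I2]) (use Min_bounds in simp)
  show "0 \<le> mean_cost rho N p S"
    unfolding mean_cost_def by (rule integral_nonneg_AE, rule AE_I2) (use Min_bounds in simp)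
qed

text \<open>Positivity of \<open>p\<close> gives continuity at the points of \<open>T\<close>, where
  the base of the power vanishes.\<close>

lemma continuous_on_Min_dist_powr:
  fixes X :: "'a::metric_space set"
  assumes "finite T" "T \<noteq> {}" "0 < p"
  shows "continuous_on X (\<lambda>y. Min ((\<lambda>x. dist y x powr p) ` T))"
  using assms(1,2)
proof (induction rule: finite_ne_induct)
  case (singleton t)
  then show ?case
    using \<open>0 < p\<close> by (auto intro!: continuous_intros continuous_on_powr')
next
  case (insert t F)
  have "continuous_on X (\<lambda>y. min (dist y t powr p) (Min ((\<lambda>x. dist y x powr p) ` F)))"
    using insert.IH \<open>0 < p\<close> by (intro continuous_intros continuous_on_powr') auto
  then show ?case using insert by simp
qed

lemma uniformly_continuous_powr:
  fixes p :: real
  assumes "0 < p" "0 < c"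
  obtains \<gamma> where "0 < \<gamma>"
    "\<And>u v. 0 \<le> u \<Longrightarrow> u \<le> B \<Longrightarrow> 0 \<le> v \<Longrightarrow> v \<le> B \<Longrightarrow> \<bar>u - v\<bar> < \<gamma> \<Longrightarrow> \<bar>u powr p - v powr p\<bar> < c"
proof -
  have "continuous_on {0..B} (\<lambda>u::real. u powr p)"
    using \<open>0 < p\<close> by (intro continuous_on_powr' continuous_intros) auto
  then have "uniformly_continuous_on {0..B} (\<lambda>u::real. u powr p)"
    by (rule compact_uniformly_continuous) simp
  then obtain \<gamma> where "\<gamma> > 0" "\<And>u v. u \<in> {0..B} \<Longrightarrow> v \<in> {0..B} \<Longrightarrow> dist v u < \<gamma> \<Longrightarrow>
      dist (v powr p) (u powr p) < c"
    unfolding uniformly_continuous_on_def using \<open>0 < c\<close> by metis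
  then show ?thesis by (intro that[of \<gamma>]) (auto simp: dist_real_def)
qed

section \<open>Finite sets as tuples, and their subsequential limits\<close>

text \<open>Encodes sets of varying cardinality as tuples of the fixed length \<open>k\<close>, so
  that limits can be taken entry by entry.\<close>

lemma finite_eq_image_lessThan:
  assumes "finite S" "S \<noteq> {}" "card S \<le> k"
  shows "\<exists>g :: nat \<Rightarrow> 'b. S = g ` {..<k}"
proof -
  obtain f :: "nat \<Rightarrow> 'b" where f: "bij_betw f {0..<card S} S"
    using ex_bij_betw_nat_finite[OF \<open>finite S\<close>] by blast
  have "card S > 0" using assms by (simp add: card_gt_0_iff)
  \<comment> \<open>Surplus positions repeat the entry at index 0, which exists because
    \<open>S\<close> is nonempty.\<close>
  have "S = (\<lambda>j. f (if j < card S then j else 0)) ` {..<k}"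
  proof (intro equalityI subsetI)
    fix s assume "s \<in> S"
    then obtain j where "j < card S" "s = f j"
      using f by (force simp: bij_betw_def)
    then show "s \<in> (\<lambda>j. f (if j < card S then j else 0)) ` {..<k}"
      using assms(3) by (intro image_eqI[of _ _ j]) auto
  next
    fix s assume "s \<in> (\<lambda>j. f (if j < card S then j else 0)) ` {..<k}"
    then show "s \<in> S"
      using bij_betwE[OF f] \<open>card S > 0\<close> by auto
  qed
  then show ?thesis by blast
qed

text \<open>One further extraction per coordinate suffices, as limits already obtained survive
  passing to a subsequence.\<close>

lemma compact_simultaneous_subsequence:
  fixes X :: "'a::metric_space set" and f :: "nat \<Rightarrow> nat \<Rightarrow> 'a"
  assumes "compact X" "\<And>i j. j < k \<Longrightarrow> f i j \<in> X"
  shows "\<exists>\<sigma> l. strict_mono \<sigma> \<and> (\<forall>j<k. l j \<in> X \<and> (\<lambda>i. f (\<sigma> i) j) \<longlonglongrightarrow> l j)"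
  using assms(2)
proof (induction k)
  case 0
  show ?case using strict_mono_id by auto
next
  case (Suc k)
  then obtain \<sigma> l where \<sigma>: "strict_mono \<sigma>"
    and l: "\<forall>j<k. l j \<in> X \<and> (\<lambda>i. f (\<sigma> i) j) \<longlonglongrightarrow> l j"
    by fastforce
  obtain a \<tau> where a: "a \<in> X" and \<tau>: "strict_mono \<tau>" and
    lim: "((\<lambda>i. f (\<sigma> i) k) \<circ> \<tau>) \<longlonglongrightarrow> a"
    using \<open>compact X\<close> Suc.prems unfolding compact_def by (metis lessI)
  have "strict_mono (\<sigma> \<circ> \<tau>)" using \<sigma> \<tau> by (rule strict_mono_o)
  moreover have "(l(k := a)) j \<in> X \<and> (\<lambda>i. f ((\<sigma> \<circ> \<tau>) i) j) \<longlonglongrightarrow> (l(k := a)) j"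
    if "j < Suc k" for j
  proof (cases "j = k")
    case True
    then show ?thesis using a lim by (simp add: comp_def)
  next
    case False
    then have "l j \<in> X" "(\<lambda>i. f (\<sigma> i) j) \<longlonglongrightarrow> l j" using l that by auto
    then show ?thesis
      using False LIMSEQ_subseq_LIMSEQ[OF _ \<tau>, of "\<lambda>i. f (\<sigma> i) j"] by (simp add: comp_def)
  qed
  ultimately show ?case by blast
qed

lemma hausdorff_distance_le:
  assumes "A \<noteq> {}" "B \<noteq> {}"
    and AB: "\<And>a. a \<in> A \<Longrightarrow> \<exists>b\<in>B. dist a b \<le> c"
    and BA: "\<And>b. b \<in> B \<Longrightarrow> \<exists>a\<in>A. dist a b \<le> c"
  shows "hausdorff_distance A B \<le> c"
proof -
  have "infdist a B \<le> c" if "a \<in> A" for a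
    using AB[OF that] infdist_le2 by blast
  moreover have "infdist b A \<le> c" if "b \<in> B" for b
    using BA[OF that] infdist_le2 by (metis dist_commute)
  ultimately show ?thesis
    unfolding hausdorff_distance_def using assms by (auto intro!: cSUP_least)
qed

section \<open>Convergence of costs along a measured Gromov-Hausdorff approximation\<close>

text \<open>The pair \<open>e\<close>, \<open>h\<close> is an arbitrary realization of the
  convergence, since closeness of barycenters is claimed for every realization and not just for the
  net maps.\<close>

locale mGH_approximation =
  fixes X :: "'a::metric_space set" and M :: "'a measure"
    and A :: "nat \<Rightarrow> 'b set" and d :: "nat \<Rightarrow> 'b \<Rightarrow> 'b \<Rightarrow> real" and m :: "nat \<Rightarrow> 'b measure"
    and e :: "nat \<Rightarrow> real" and h :: "nat \<Rightarrow> 'b \<Rightarrow> 'a" and p :: real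
  assumes compact: "compact X"
    and prob: "prob_space M"
    and sets: "sets M = sets (restrict_space borel X)"
    and prob_m: "\<And>n. prob_space (m n)"
    and sets_m: "\<And>n. sets (m n) = Pow (A n)"
    and d_nonneg: "\<And>n u v. u \<in> A n \<Longrightarrow> v \<in> A n \<Longrightarrow> 0 \<le> d n u v"
    and mGH: "realizes_mGH A d m X M e h"
    and p_pos: "0 < p"
begin

lemma space: "space M = X"
  using sets_eq_imp_space_eq[OF sets] by (simp add: space_restrict_space)

lemma space_m: "space (m n) = A n"
  using sets_m[of n] by (metis Pow_top Sup_upper Union_Pow_eq sets.top sets.sets_into_space subset_antisym PowD)

lemma e_tendsto: "e \<longlonglongrightarrow> 0"
  using mGH by (simp add: realizes_mGH_def)

lemma h_in: "a \<in> A n \<Longrightarrow> h n a \<in> X"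
  using mGH by (auto simp: realizes_mGH_def eps_isometry_def)

lemma h_dist: "a \<in> A n \<Longrightarrow> b \<in> A n \<Longrightarrow> \<bar>d n a b - dist (h n a) (h n b)\<bar> < e n"
  using mGH by (auto simp: realizes_mGH_def eps_isometry_def)

lemma h_dense:
  assumes "t \<in> X"
  shows "\<exists>a\<in>A n. dist (h n a) t < e n"
proof -
  have "infdist t (h n ` A n) < e n"
    using mGH assms by (auto simp: realizes_mGH_def eps_isometry_def)
  \<comment> \<open>As \<open>infdist\<close> to the empty set is 0, a point of the image can be
    extracted only once the image is known to be nonempty.\<close>
  moreover have "h n ` A n \<noteq> {}"
    using prob_space.not_empty[OF prob_m[of n]] space_m by simp
  ultimately have "\<exists>y\<in>h n ` A n. dist t y < e n"
    unfolding infdist_def by (simp add: cINF_less_iff)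
  then show ?thesis by (auto simp: dist_commute)
qed

lemma h_measurable: "h n \<in> measurable (m n) M"
  using mGH by (simp add: realizes_mGH_def)

lemma measurable_m:
  fixes f :: "'b \<Rightarrow> real"
  shows "f \<in> borel_measurable (m n)"
  by (rule measurableI) (auto simp: sets_m space_m)

lemma borel_measurable_continuous:
  fixes f :: "'a \<Rightarrow> real"
  assumes "continuous_on X f"
  shows "f \<in> borel_measurable M"
  using borel_measurable_continuous_on_restrict[OF assms]
  by (simp cong: measurable_cong_sets add: sets)

lemma dist_bounded:
  obtains D where "\<And>x y. x \<in> X \<Longrightarrow> y \<in> X \<Longrightarrow> dist x y \<le> D"
proof -
  have "bounded X" using compact by (rule compact_imp_bounded)
  then show ?thesis
    using that[of "diameter X"] diameter_bounded_bound[of X] by blast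
qed

text \<open>The bound on \<open>X\<close> is carried back through \<open>h n\<close>, up to the
  distortion \<open>e n\<close>.\<close>

lemma d_bounded:
  obtains B where "\<And>x y. x \<in> A n \<Longrightarrow> y \<in> A n \<Longrightarrow> d n x y \<le> B"
proof -
  obtain D where D: "\<And>x y. x \<in> X \<Longrightarrow> y \<in> X \<Longrightarrow> dist x y \<le> D"
    using dist_bounded by blast
  show ?thesis
  proof (rule that[of "D + e n"])
    fix x y assume xy: "x \<in> A n" "y \<in> A n"
    show "d n x y \<le> D + e n"
      using h_dist[OF xy] D[OF h_in h_in, OF xy] by linarith
  qed
qed

lemma limit_cost:
  assumes "T \<in> admissible_sets X k"
  shows "barycenter_cost dist M p T = ennreal (mean_cost dist M p T)"
proof -
  obtain D where D: "\<And>x y. x \<in> X \<Longrightarrow> y \<in> X \<Longrightarrow> dist x y \<le> D"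
    using dist_bounded by blast
  have T: "T \<subseteq> X" "T \<noteq> {}" "finite T" using assms by (auto simp: admissible_sets_def)
  have p: "0 \<le> p" using p_pos by simp
  have b: "0 \<le> dist y x \<and> dist y x \<le> D" if "x \<in> T" "y \<in> space M" for x y
    using D T that space by auto
  have meas: "(\<lambda>y. Min ((\<lambda>x. dist y x powr p) ` T)) \<in> borel_measurable M"
    by (intro borel_measurable_continuous continuous_on_Min_dist_powr T p_pos)
  show "barycenter_cost dist M p T = ennreal (mean_cost dist M p T)"
    using barycenter_cost_eq_mean_cost[OF prob T(3,2) p b meas] .
qed

lemma
  assumes "S \<in> admissible_sets (A n) k"
  shows approx_integrable: "integrable (m n) (\<lambda>y. Min ((\<lambda>x. d n y x powr p) ` S))"
    and approx_cost: "barycenter_cost (d n) (m n) p S = ennreal (mean_cost (d n) (m n) p S)"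
    and approx_cost_nonneg: "0 \<le> mean_cost (d n) (m n) p S"
proof -
  obtain B where B: "\<And>x y. x \<in> A n \<Longrightarrow> y \<in> A n \<Longrightarrow> d n x y \<le> B"
    using d_bounded[of n] by blast
  have S: "S \<subseteq> A n" "S \<noteq> {}" "finite S" using assms by (auto simp: admissible_sets_def)
  have p: "0 \<le> p" using p_pos by simp
  have b: "0 \<le> d n y x \<and> d n y x \<le> B" if "x \<in> S" "y \<in> space (m n)" for x y
    using B S that space_m d_nonneg by auto
  show "integrable (m n) (\<lambda>y. Min ((\<lambda>x. d n y x powr p) ` S))"
    using integrable_Min_powr[OF prob_m S(3,2) p b measurable_m] .
  show "barycenter_cost (d n) (m n) p S = ennreal (mean_cost (d n) (m n) p S)"
    using barycenter_cost_eq_mean_cost[OF prob_m S(3,2) p b measurable_m] .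
  show "0 \<le> mean_cost (d n) (m n) p S"
    using mean_cost_nonneg[OF prob_m S(3,2) p b measurable_m] .
qed

text \<open>The integral of \<open>F\<close> along \<open>h n\<close>, where \<open>F\<close> is the
  integrand of the cost of \<open>T\<close>, lies between the two costs: uniform continuity of the
  power compares it with the cost of \<open>S\<close>, weak convergence with that of
  \<open>T\<close>. Both \<open>\<delta>\<close> and the threshold for \<open>n\<close> are uniform
  in \<open>S\<close>.\<close>

lemma mean_cost_stable:
  assumes T: "T \<in> admissible_sets X k" and "0 < \<eta>"
  obtains \<delta> where "0 < \<delta>"
    "\<forall>\<^sub>F n in sequentially. \<forall>S \<in> admissible_sets (A n) l.
       (\<forall>s\<in>S. \<exists>t\<in>T. dist (h n s) t < \<delta>) \<longrightarrow> (\<forall>t\<in>T. \<exists>s\<in>S. dist (h n s) t < \<delta>) \<longrightarrow>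
       \<bar>mean_cost (d n) (m n) p S - mean_cost dist M p T\<bar> < \<eta>"
proof -
  obtain D where D: "\<And>x y. x \<in> X \<Longrightarrow> y \<in> X \<Longrightarrow> dist x y \<le> D"
    using dist_bounded by blast
  \<comment> \<open>The extra 1 makes room for the distortion of \<open>h n\<close>, which can push
    \<open>d n\<close> above \<open>D\<close>.\<close>
  obtain \<gamma> where \<gamma>: "0 < \<gamma>" and powr: "\<And>u v. 0 \<le> u \<Longrightarrow> u \<le> D + 1 \<Longrightarrow> 0 \<le> v \<Longrightarrow> v \<le> D + 1 \<Longrightarrow>
      \<bar>u - v\<bar> < \<gamma> \<Longrightarrow> \<bar>u powr p - v powr p\<bar> < \<eta> / 2"
    using uniformly_continuous_powr[OF p_pos, of "\<eta> / 2" "D + 1"] \<open>0 < \<eta>\<close> by auto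
  have T': "T \<subseteq> X" "T \<noteq> {}" "finite T" using T by (auto simp: admissible_sets_def)
  define F where "F y = Min ((\<lambda>x. dist y x powr p) ` T)" for y
  have F_cont: "continuous_on X F"
    unfolding F_def using continuous_on_Min_dist_powr[OF T'(3,2) p_pos] .
  have F_meas: "F \<in> borel_measurable M"
    by (rule borel_measurable_continuous) fact
  have F_bound: "0 \<le> F y \<and> F y \<le> D powr p" if "y \<in> X" for y
    using Min_powr_bounds[OF T'(3,2), of p dist y D] p_pos D T'(1) that
    unfolding F_def by auto
  have "bounded (F ` X)"
    using compact_continuous_image[OF F_cont compact] by (rule compact_imp_bounded)
  then have "(\<lambda>n. integral\<^sup>L (distr (m n) M (h n)) F) \<longlonglongrightarrow> integral\<^sup>L M F"
    using mGH F_cont by (auto simp: realizes_mGH_def converges_weakly_def)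
  moreover have "integral\<^sup>L M F = mean_cost dist M p T"
    by (simp add: mean_cost_def F_def[abs_def])
  ultimately have lim: "(\<lambda>n. integral\<^sup>L (m n) (\<lambda>y. F (h n y))) \<longlonglongrightarrow> mean_cost dist M p T"
    by (simp add: integral_distr[OF h_measurable F_meas])
  have close: "\<forall>\<^sub>F n in sequentially. \<bar>integral\<^sup>L (m n) (\<lambda>y. F (h n y)) - mean_cost dist M p T\<bar> < \<eta> / 2"
    using tendstoD[OF lim, of "\<eta> / 2"] \<open>0 < \<eta>\<close> by (simp add: dist_real_def)
  \<comment> \<open>The bound 1 keeps \<open>d n\<close> below \<open>D + 1\<close>. Half of
    \<open>\<gamma>\<close> is reserved for the distortion, the other half for replacing
    \<open>h n s\<close> by \<open>t\<close>.\<close>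
  have small: "\<forall>\<^sub>F n in sequentially. e n < min 1 (\<gamma> / 2)"
    by (rule order_tendstoD(2)[OF e_tendsto]) (use \<gamma> in auto)
  show ?thesis
  proof (rule that[of "\<gamma> / 2"])
    show "\<forall>\<^sub>F n in sequentially. \<forall>S \<in> admissible_sets (A n) l.
       (\<forall>s\<in>S. \<exists>t\<in>T. dist (h n s) t < \<gamma> / 2) \<longrightarrow> (\<forall>t\<in>T. \<exists>s\<in>S. dist (h n s) t < \<gamma> / 2) \<longrightarrow>
       \<bar>mean_cost (d n) (m n) p S - mean_cost dist M p T\<bar> < \<eta>"
      using close small
    proof eventually_elim
      case (elim n)
      show ?case
      proof (intro ballI impI)
        fix S assume S: "S \<in> admissible_sets (A n) l"
          and ST: "\<forall>s\<in>S. \<exists>t\<in>T. dist (h n s) t < \<gamma> / 2"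
          and TS: "\<forall>t\<in>T. \<exists>s\<in>S. dist (h n s) t < \<gamma> / 2"
        interpret mn: prob_space "m n" by (rule prob_m)
        have S': "S \<subseteq> A n" "S \<noteq> {}" "finite S" using S by (auto simp: admissible_sets_def)
        let ?f = "\<lambda>y. Min ((\<lambda>x. d n y x powr p) ` S)"
        have near: "\<bar>d n y s powr p - dist (h n y) t powr p\<bar> \<le> \<eta> / 2"
          if "y \<in> A n" "s \<in> S" "t \<in> T" "dist (h n s) t < \<gamma> / 2" for y s t
        proof (rule less_imp_le, rule powr)
          have s: "s \<in> A n" and t: "t \<in> X" using that S' T' by auto
          note hd = h_dist[OF that(1) s]
          have hh: "dist (h n y) (h n s) \<le> D" "dist (h n y) t \<le> D"
            using D h_in that(1) s t by auto
          show "0 \<le> d n y s" using d_nonneg that(1) s by simp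
          show "d n y s \<le> D + 1" using hd hh elim by linarith
          show "dist (h n y) t \<le> D + 1" using hh by linarith
          have "\<bar>dist (h n y) (h n s) - dist (h n y) t\<bar> \<le> dist (h n s) t"
            by (metis abs_dist_diff_le dist_commute)
          then show "\<bar>d n y s - dist (h n y) t\<bar> < \<gamma>"
            using hd that(4) elim by linarith
        qed simp
        have diff: "\<bar>?f y - F (h n y)\<bar> \<le> \<eta> / 2" if "y \<in> A n" for y
          unfolding F_def
          by (rule abs_Min_diff_le[OF S'(3,2) T'(3,2)]) (use near[OF that] ST TS in blast)+
        have int_F: "integrable (m n) (\<lambda>y. F (h n y))"
          by (rule mn.integrable_const_bound[of _ "D powr p", OF AE_I2 measurable_m])
            (use F_bound h_in space_m in auto)
        note int_f = approx_integrable[OF S]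
        have "\<bar>integral\<^sup>L (m n) ?f - integral\<^sup>L (m n) (\<lambda>y. F (h n y))\<bar>
            = \<bar>integral\<^sup>L (m n) (\<lambda>y. ?f y - F (h n y))\<bar>"
          by (simp add: Bochner_Integration.integral_diff[OF int_f int_F])
        also have "\<dots> \<le> integral\<^sup>L (m n) (\<lambda>y. \<bar>?f y - F (h n y)\<bar>)"
          by (rule integral_abs_bound)
        also have "\<dots> \<le> \<eta> / 2"
          by (rule mn.integral_le_const[OF _ AE_I2])
            (use diff space_m int_f int_F in auto)
        finally show "\<bar>mean_cost (d n) (m n) p S - mean_cost dist M p T\<bar> < \<eta>"
          using elim unfolding mean_cost_def[of "d n"] by linarith
      qed
    qed
  qed (use \<gamma> in simp)
qed

text \<open>One nearby point is picked for each \<open>t\<close>. Picks may coincide, which only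
  lowers the cardinality.\<close>

lemma approximating_admissible_set:
  assumes "T \<in> admissible_sets X k" "0 < \<delta>" "e n < \<delta>"
  obtains S where "S \<in> admissible_sets (A n) k"
    "\<forall>s\<in>S. \<exists>t\<in>T. dist (h n s) t < \<delta>" "\<forall>t\<in>T. \<exists>s\<in>S. dist (h n s) t < \<delta>"
proof -
  have T: "T \<subseteq> X" "T \<noteq> {}" "finite T" "card T \<le> k"
    using assms(1) by (auto simp: admissible_sets_def)
  have "\<exists>a\<in>A n. dist (h n a) t < \<delta>" if "t \<in> T" for t
    using h_dense[of t n] T(1) that assms(3) by (meson less_trans subsetD)
  then obtain a where a: "\<And>t. t \<in> T \<Longrightarrow> a t \<in> A n \<and> dist (h n (a t)) t < \<delta>"
    by metis
  show ?thesis
  proof (rule that[of "a ` T"])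
    show "a ` T \<in> admissible_sets (A n) k"
      using a T card_image_le[OF T(3), of a] by (auto simp: admissible_sets_def)
  qed (use a in auto)
qed

section \<open>Limits of barycenters\<close>

text \<open>A competitor strictly better than \<open>T\<close> could be approximated inside
  \<open>A (r i)\<close>, where for large \<open>i\<close> it would beat the minimizer
  \<open>S i\<close>.\<close>

lemma barycenters_subsequence:
  assumes r: "filterlim r at_top sequentially"
    and S: "\<And>i. S i \<in> k_barycenters (A (r i)) (d (r i)) (m (r i)) p k"
    and T: "T \<in> admissible_sets X k"
    and lim: "\<And>\<delta>. 0 < \<delta> \<Longrightarrow> \<forall>\<^sub>F i in sequentially.
        (\<forall>s\<in>S i. \<exists>t\<in>T. dist (h (r i) s) t < \<delta>) \<and> (\<forall>t\<in>T. \<exists>s\<in>S i. dist (h (r i) s) t < \<delta>)"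
  shows "T \<in> k_barycenters X dist M p k"
  unfolding k_barycenters_def mem_Collect_eq
proof (intro conjI ballI T)
  fix T' assume T': "T' \<in> admissible_sets X k"
  have "mean_cost dist M p T \<le> mean_cost dist M p T'"
  proof (rule ccontr)
    assume "\<not> ?thesis"
    \<comment> \<open>Half the gap: errors below \<open>\<eta>\<close> on both sides cannot reverse
      the strict inequality.\<close>
    define \<eta> where "\<eta> = (mean_cost dist M p T - mean_cost dist M p T') / 2"
    then have "0 < \<eta>" using \<open>\<not> _\<close> by simp
    obtain \<delta> where \<delta>: "0 < \<delta>" and
      ev: "\<forall>\<^sub>F n in sequentially. \<forall>S \<in> admissible_sets (A n) k.
       (\<forall>s\<in>S. \<exists>t\<in>T. dist (h n s) t < \<delta>) \<longrightarrow> (\<forall>t\<in>T. \<exists>s\<in>S. dist (h n s) t < \<delta>) \<longrightarrow>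
       \<bar>mean_cost (d n) (m n) p S - mean_cost dist M p T\<bar> < \<eta>"
      using mean_cost_stable[OF T \<open>0 < \<eta>\<close>] by blast
    obtain \<delta>' where \<delta>': "0 < \<delta>'" and
      ev': "\<forall>\<^sub>F n in sequentially. \<forall>S \<in> admissible_sets (A n) k.
       (\<forall>s\<in>S. \<exists>t\<in>T'. dist (h n s) t < \<delta>') \<longrightarrow> (\<forall>t\<in>T'. \<exists>s\<in>S. dist (h n s) t < \<delta>') \<longrightarrow>
       \<bar>mean_cost (d n) (m n) p S - mean_cost dist M p T'\<bar> < \<eta>"
      using mean_cost_stable[OF T' \<open>0 < \<eta>\<close>] by blast
    have small: "\<forall>\<^sub>F n in sequentially. e n < \<delta>'"
      by (rule order_tendstoD(2)[OF e_tendsto \<delta>'])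
    note sub = eventually_compose_filterlim[OF _ r]
    have "\<forall>\<^sub>F i in sequentially. False"
      using sub[OF ev] sub[OF ev'] sub[OF small] lim[OF \<delta>]
    proof eventually_elim
      case (elim i)
      obtain S' where S': "S' \<in> admissible_sets (A (r i)) k"
        "\<forall>s\<in>S'. \<exists>t\<in>T'. dist (h (r i) s) t < \<delta>'" "\<forall>t\<in>T'. \<exists>s\<in>S'. dist (h (r i) s) t < \<delta>'"
        using approximating_admissible_set[OF T' \<delta>' elim(3)] .
      have Si: "S i \<in> admissible_sets (A (r i)) k"
        using S[of i] by (simp add: k_barycenters_def)
      have "barycenter_cost (d (r i)) (m (r i)) p (S i) \<le> barycenter_cost (d (r i)) (m (r i)) p S'"
        using S[of i] S'(1) by (simp add: k_barycenters_def)
      \<comment> \<open>Leaving \<open>ennreal\<close> requires the larger side to be nonnegative,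
        because negative reals are truncated to 0.\<close>
      then have "mean_cost (d (r i)) (m (r i)) p (S i) \<le> mean_cost (d (r i)) (m (r i)) p S'"
        by (simp add: approx_cost[OF Si] approx_cost[OF S'(1)] approx_cost_nonneg[OF S'(1)])
      moreover have "\<bar>mean_cost (d (r i)) (m (r i)) p (S i) - mean_cost dist M p T\<bar> < \<eta>"
        using elim(1,4) Si by blast
      moreover have "\<bar>mean_cost (d (r i)) (m (r i)) p S' - mean_cost dist M p T'\<bar> < \<eta>"
        using elim(2) S' by blast
      moreover have "mean_cost dist M p T - \<eta> = mean_cost dist M p T' + \<eta>"
        by (simp add: \<eta>_def field_simps)
      ultimately show False by linarith
    qed
    then show False by simp
  qed
  then show "barycenter_cost dist M p T \<le> barycenter_cost dist M p T'"
    by (simp add: limit_cost[OF T] limit_cost[OF T'] ennreal_leI)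
qed

lemma barycenters_eventually_close:
  assumes "1 \<le> k" "0 < \<epsilon>"
  shows "\<exists>n0. \<forall>n\<ge>n0. \<forall>S \<in> k_barycenters (A n) (d n) (m n) p k.
           \<exists>T \<in> k_barycenters X dist M p k. hausdorff_distance (h n ` S) T < \<epsilon>"
proof (rule ccontr)
  assume "\<not> ?thesis"
  then have "\<forall>i. \<exists>n S. i \<le> n \<and> S \<in> k_barycenters (A n) (d n) (m n) p k \<and>
      (\<forall>T \<in> k_barycenters X dist M p k. \<not> hausdorff_distance (h n ` S) T < \<epsilon>)"
    by blast
  \<comment> \<open>The counterexample indices \<open>r i\<close> need not increase;
    \<open>i \<le> r i\<close> already forces them to infinity.\<close>
  then obtain r S where r: "\<And>i. i \<le> r i"
    and S: "\<And>i. S i \<in> k_barycenters (A (r i)) (d (r i)) (m (r i)) p k"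
    and far: "\<And>i T. T \<in> k_barycenters X dist M p k \<Longrightarrow> \<not> hausdorff_distance (h (r i) ` S i) T < \<epsilon>"
    by metis
  have Si: "S i \<subseteq> A (r i)" "S i \<noteq> {}" "finite (S i)" "card (S i) \<le> k" for i
    using S[of i] by (auto simp: k_barycenters_def admissible_sets_def)
  have "\<exists>g. S i = g ` {..<k}" for i
    using finite_eq_image_lessThan[OF Si(3,2,4)] by blast
  then obtain g where g: "\<And>i. S i = g i ` {..<k}" by metis
  have gX: "h (r i) (g i j) \<in> X" if "j < k" for i j
    using Si(1)[of i] g[of i] that by (auto intro: h_in)
  obtain \<sigma> l where \<sigma>: "strict_mono \<sigma>" and
    l: "\<And>j. j < k \<Longrightarrow> l j \<in> X \<and> (\<lambda>i. h (r (\<sigma> i)) (g (\<sigma> i) j)) \<longlonglongrightarrow> l j"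
    using compact_simultaneous_subsequence[OF compact, of k "\<lambda>i j. h (r i) (g i j)"] gX by blast
  \<comment> \<open>Limits of different entries may coincide, so \<open>T\<close> has at most
    \<open>k\<close> points; it is nonempty because \<open>1 \<le> k\<close>.\<close>
  define T where "T = l ` {..<k}"
  have T: "T \<in> admissible_sets X k"
    using l \<open>1 \<le> k\<close> card_image_le[of "{..<k}" l]
    by (auto simp: T_def admissible_sets_def lessThan_empty_iff)
  have lim: "\<forall>\<^sub>F i in sequentially. (\<forall>s\<in>S (\<sigma> i). \<exists>t\<in>T. dist (h (r (\<sigma> i)) s) t < \<delta>) \<and>
      (\<forall>t\<in>T. \<exists>s\<in>S (\<sigma> i). dist (h (r (\<sigma> i)) s) t < \<delta>)" if "0 < \<delta>" for \<delta>
  proof -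
    have "\<forall>\<^sub>F i in sequentially. \<forall>j\<in>{..<k}. dist (h (r (\<sigma> i)) (g (\<sigma> i) j)) (l j) < \<delta>"
      by (intro eventually_ball_finite ballI) (use l that in \<open>auto intro: tendstoD\<close>)
    then show ?thesis
      by eventually_elim (auto simp: T_def g)
  qed
  have "i \<le> r (\<sigma> i)" for i
    using r[of "\<sigma> i"] strict_mono_imp_increasing[OF \<sigma>, of i] by linarith
  then have "filterlim (\<lambda>i. r (\<sigma> i)) at_top sequentially"
    by (intro filterlim_at_top_mono[OF filterlim_ident] always_eventually) auto
  then have Tb: "T \<in> k_barycenters X dist M p k"
    by (rule barycenters_subsequence[OF _ S T lim])
  \<comment> \<open>Closeness within half of \<open>\<epsilon>\<close> leaves room for the
    non-strict bound on the Hausdorff distance.\<close>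
  have "\<exists>i. (\<forall>s\<in>S (\<sigma> i). \<exists>t\<in>T. dist (h (r (\<sigma> i)) s) t < \<epsilon> / 2) \<and>
      (\<forall>t\<in>T. \<exists>s\<in>S (\<sigma> i). dist (h (r (\<sigma> i)) s) t < \<epsilon> / 2)"
    using eventually_happens'[OF _ lim[of "\<epsilon> / 2"]] \<open>0 < \<epsilon>\<close> by simp
  then obtain i where i: "\<forall>s\<in>S (\<sigma> i). \<exists>t\<in>T. dist (h (r (\<sigma> i)) s) t < \<epsilon> / 2"
      "\<forall>t\<in>T. \<exists>s\<in>S (\<sigma> i). dist (h (r (\<sigma> i)) s) t < \<epsilon> / 2"
    by blast
  have "hausdorff_distance (h (r (\<sigma> i)) ` S (\<sigma> i)) T \<le> \<epsilon> / 2"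
  proof (rule hausdorff_distance_le)
    show "T \<noteq> {}" using T by (simp add: admissible_sets_def)
    show "\<exists>b\<in>T. dist a b \<le> \<epsilon> / 2" if "a \<in> h (r (\<sigma> i)) ` S (\<sigma> i)" for a
      using i(1) that by (fastforce intro: less_imp_le)
    show "\<exists>a\<in>h (r (\<sigma> i)) ` S (\<sigma> i). dist a b \<le> \<epsilon> / 2" if "b \<in> T" for b
      using i(2) that by (fastforce intro: less_imp_le)
  qed (use Si in simp)
  then show False
    using far[OF Tb, of "\<sigma> i"] \<open>0 < \<epsilon>\<close> by simp
qed

end

section \<open>The approximating graphs and their barycenters\<close>

theorem proposition3p20:
  fixes X :: "'a::metric_space set" and M :: "'a measure"
  assumes "compact X"
    and "length_space X"
    and "prob_space M"
    and "sets M = sets (restrict_space borel X)"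
  shows "\<exists>(G :: nat \<Rightarrow> nat pair_pre_digraph) (w :: nat \<Rightarrow> nat \<times> nat \<Rightarrow> real)
            (d :: nat \<Rightarrow> nat \<Rightarrow> nat \<Rightarrow> real) (m :: nat \<Rightarrow> nat measure).
    (\<forall>n. metric_graph (G n) (w n) \<and> d n = graph_dist (G n) (w n) \<and>
         prob_space (m n) \<and> sets (m n) = Pow (pverts (G n))) \<and>
    mGH_converges (\<lambda>n. pverts (G n)) d m X M \<and>
    (\<forall>e h. realizes_mGH (\<lambda>n. pverts (G n)) d m X M e h \<longrightarrow>
      (\<forall>(k::nat) (p::real) (\<epsilon>::real). 1 \<le> k \<longrightarrow> 1 \<le> p \<longrightarrow> 0 < \<epsilon> \<longrightarrow>
        (\<exists>n0. \<forall>n\<ge>n0. \<forall>S \<in> k_barycenters (pverts (G n)) (d n) (m n) p k.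
           \<exists>T \<in> k_barycenters X dist M p k. hausdorff_distance (h n ` S) T < \<epsilon>)))"
proof -
  obtain N :: "nat \<Rightarrow> nat" and x :: "nat \<Rightarrow> nat \<Rightarrow> 'a" and m :: "nat \<Rightarrow> nat measure"
    where Nxm: "\<forall>n. N n > 0 \<and> inj_on (x n) {..<N n} \<and> prob_space (m n) \<and>
      sets (m n) = Pow {..<N n}"
    and mGH: "realizes_mGH (\<lambda>n. {..<N n}) (\<lambda>n i j. dist (x n i) (x n j)) m X M
      (\<lambda>n. inverse (real (Suc n))) x"
    using compact_metric_measure_discretization[OF assms(1,3,4)] .
  then have N: "N n > 0" and inj: "inj_on (x n) {..<N n}" and prob: "prob_space (m n)"
    and sets: "sets (m n) = Pow {..<N n}" for n
    by simp_all
  define G where "G n = complete_pair_graph {..<N n}" for n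
  define w where "w n = (\<lambda>(i, j). dist (x n i) (x n j))" for n
  define d where "d n = graph_dist (G n) (w n)" for n
  have verts: "pverts (G n) = {..<N n}" for n
    by (simp add: G_def)
  have d: "d n i j = dist (x n i) (x n j)" if "i < N n" "j < N n" for n i j
    using that by (simp add: d_def G_def w_def graph_dist_complete_pair_graph)
  have "metric_graph (G n) (w n)" for n
    unfolding G_def w_def using N[of n] inj[of n]
    by (intro metric_graph_complete_pair_graph) auto
  \<comment> \<open>Graph distance and pulled-back distance are identified on vertices only, the
    only points at which \<open>eps_isometry\<close> evaluates them.\<close>
  moreover have "realizes_mGH (\<lambda>n. pverts (G n)) d m X M (\<lambda>n. inverse (real (Suc n))) x"
    using mGH by (simp add: realizes_mGH_def eps_isometry_def verts d)
  then have "mGH_converges (\<lambda>n. pverts (G n)) d m X M"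
    unfolding mGH_converges_def by blast
  moreover have "\<exists>n0. \<forall>n\<ge>n0. \<forall>S \<in> k_barycenters (pverts (G n)) (d n) (m n) p k.
      \<exists>T \<in> k_barycenters X dist M p k. hausdorff_distance (h n ` S) T < \<epsilon>"
    if h: "realizes_mGH (\<lambda>n. pverts (G n)) d m X M e h" and "1 \<le> k" "1 \<le> p" "0 < \<epsilon>"
    for e h and k :: nat and p \<epsilon> :: real
  proof -
    have "mGH_approximation X M (\<lambda>n. pverts (G n)) d m e h p"
      by (rule mGH_approximation.intro[OF assms(1,3,4) prob _ _ h])
        (use sets verts d \<open>1 \<le> p\<close> in simp_all)
    then show ?thesis
      using \<open>1 \<le> k\<close> \<open>0 < \<epsilon>\<close> by (rule mGH_approximation.barycenters_eventually_close)
  qed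
  moreover have "\<forall>n. d n = graph_dist (G n) (w n) \<and> prob_space (m n) \<and> sets (m n) = Pow (pverts (G n))"
    using d_def prob sets verts by simp
  ultimately show ?thesis
    by (intro exI[of _ G] exI[of _ w] exI[of _ d] exI[of _ m]) simp
qed

end
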